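(* Let $\mu=(\mu_1\ge\mu_2\ge\dots\ge\mu_r)$ be a partition. Suppose there exists a sequence $a_1,\dots,a_r$ of positive integers such that the number of different permutations $\pi$ of $\mu$ satisfying $(\pi\circ\mu)_i\ge a_i$ for all $i=1,\dots,r$ is at least $|\mu|-\sum_{i=1}^r a_i+2$. Then $\mu$ admits a strongly common radical solution.
   Context: $|\mu|=\sum_i\mu_i$. Different permutations of $\mu$ means different rearrangements of the multiset of parts, i.e. distinct sequences $\pi\circ\mu=((\pi\circ\mu)_1,\dots,(\pi\circ\mu)_r)$ obtained by permuting the entries of $(\mu_1,\dots,\mu_r)$; $(\pi\circ\mu)_i$ is the $i$-th entry of the rearranged sequence. For a partition $\mu=(\mu_1\ge\dots\ge\mu_r)$ of $d$ with all $\mu_i\ge1$, $S_\mu$ is the set of complex binary forms of degree $d$ (up to nonzero constant factor) having exactly $r$ distinct roots in $\mathbb{C}P^1$, with multiplicities $\mu_1,\dots,\mu_r$. Given a positive integer $m$, a common radical solution of $f_1+\dots+f_m=0$ is a collection of pairwise non-proportional forms $f_1,\dots,f_m$ belonging to $S_\mu$, satisfying this equation, and all having the same radical, i.e. the same set of distinct linear factors (up to constant factors). The partition $\mu$ admits a strongly common radical solution if for some integer $m$ a common radical solution exists for any choice of $r$ distinct roots (i.e. with the common set of roots of all $f_i$ being the prescribed $r$-element set).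
   Formalization: The number m of forms may depend on the chosen r roots (one m for all choices fails for μ=(9,3,1,1), a=(1,1,1,1)), and a_1+...+a_r ≤ |μ| is assumed (otherwise μ=(1), a=(3) is a counterexample). *)

theory Defs
  imports
    Complex_Main
    "HOL-Library.Multiset"
    "HOL-Computational_Algebra.Polynomial_Factorial"
    "HOL-Computational_Algebra.Field_as_Ring"
    "HOL-Combinatorics.Multiset_Permutations"
begin

(* Points of the complex projective line are classes of homogeneous coordinates (u, v). *)

definition proj_rel :: "((complex \<times> complex) \<times> (complex \<times> complex)) set" where
  "proj_rel = {((u, v), (u', v')). (u, v) \<noteq> (0, 0) \<and>
                 (\<exists>c. c \<noteq> 0 \<and> u' = c * u \<and> v' = c * v)}"

definition CP1 :: "(complex \<times> complex) set set" where
  "CP1 = (UNIV - {(0, 0)}) // proj_rel"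

(* Polynomials in x, y are elements of C[x][y]: the coefficient of x^i y^j in F is
   coeff (coeff F j) i. *)

type_synonym bpoly = "complex poly poly"

definition homogeneous :: "nat \<Rightarrow> bpoly \<Rightarrow> bool" where
  "homogeneous d F \<longleftrightarrow> (\<forall>i j. coeff (coeff F j) i \<noteq> 0 \<longrightarrow> i + j = d)"

definition eval_form :: "bpoly \<Rightarrow> complex \<times> complex \<Rightarrow> complex" where
  "eval_form F = (\<lambda>(u, v). poly (poly F [:v:]) u)"

(* The linear form v x - u y, whose only zero in CP1 is the point (u : v). *)
definition linear_form :: "complex \<times> complex \<Rightarrow> bpoly" where
  "linear_form = (\<lambda>(u, v). [:[:0, v:], [:- u:]:])"

definition form_roots :: "bpoly \<Rightarrow> (complex \<times> complex) set set" where
  "form_roots F = {P \<in> CP1. \<forall>p\<in>P. eval_form F p = 0}"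

(* Well-defined by lemma root_mult_class below. *)
definition root_mult :: "bpoly \<Rightarrow> (complex \<times> complex) set \<Rightarrow> nat" where
  "root_mult F P = (THE k. \<forall>p\<in>P. multiplicity (linear_form p) F = k)"

definition proportional :: "bpoly \<Rightarrow> bpoly \<Rightarrow> bool" where
  "proportional F G \<longleftrightarrow> (\<exists>c. c \<noteq> 0 \<and> G = smult [:c:] F)"

definition is_partition :: "nat list \<Rightarrow> bool" where
  "is_partition \<mu> \<longleftrightarrow> sorted_wrt (\<ge>) \<mu> \<and> (\<forall>k\<in>set \<mu>. 1 \<le> k)"

(* The equation of multisets says that there are exactly length \<mu> distinct roots and that
   their multiplicities are the parts of \<mu>. Forms are not identified with their nonzero
   multiples here, but the set is closed under nonzero scaling. *)
definition S_stratum :: "nat list \<Rightarrow> bpoly set" where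
  "S_stratum \<mu> = {F. F \<noteq> 0 \<and> homogeneous (sum_list \<mu>) F \<and>
                     image_mset (root_mult F) (mset_set (form_roots F)) = mset \<mu>}"

(* Equality of the sets of distinct linear factors up to constants is expressed as equality of
   the sets of roots in CP1. *)
definition common_radical_solution :: "nat list \<Rightarrow> nat \<Rightarrow> (nat \<Rightarrow> bpoly) \<Rightarrow> bool" where
  "common_radical_solution \<mu> m f \<longleftrightarrow>
     0 < m \<and>
     (\<forall>i<m. f i \<in> S_stratum \<mu>) \<and>
     (\<forall>i<m. \<forall>j<m. i \<noteq> j \<longrightarrow> \<not> proportional (f i) (f j)) \<and>
     (\<Sum>i<m. f i) = 0 \<and>
     (\<forall>i<m. \<forall>j<m. form_roots (f i) = form_roots (f j))"

(* The number m of forms may depend on the prescribed roots. A single m for all choices of roots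
   is not always possible: for the partition 9, 3, 1, 1 and the roots 0, infinity, 1, t a
   solution needs m = 12 for generic t, but m = 8 when 3 t^2 - 8 t + 3 = 0. *)
definition admits_strongly_common_radical_solution :: "nat list \<Rightarrow> bool" where
  "admits_strongly_common_radical_solution \<mu> \<longleftrightarrow>
     (\<forall>R \<subseteq> CP1. finite R \<and> card R = length \<mu> \<longrightarrow>
        (\<exists>m f. common_radical_solution \<mu> m f \<and> (\<forall>i<m. form_roots (f i) = R)))"

lemma root_mult_class:
  assumes "p \<noteq> (0, 0)"
  shows "root_mult F (proj_rel `` {p}) = multiplicity (linear_form p) F"
proof -
  obtain u v where p: "p = (u, v)" by fastforce
  have mult: "multiplicity (linear_form q) F = multiplicity (linear_form p) F"
    if "q \<in> proj_rel `` {p}" for q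
  proof -
    from that obtain c where c: "c \<noteq> 0" "q = (c * u, c * v)"
      by (auto simp: proj_rel_def p)
    have "linear_form q = [:[:c:]:] * linear_form p"
      by (simp add: linear_form_def p c)
    moreover have "is_unit [:[:c:]:]"
      using c(1) by (simp only: is_unit_const_poly_iff dvd_field_iff simp_thms)
    ultimately show ?thesis
      using multiplicity_times_unit_left[of "[:[:c:]:]" "linear_form p" F] by argo
  qed
  have "p \<in> proj_rel `` {p}"
  proof -
    have "\<exists>c. c \<noteq> 0 \<and> u = c * u \<and> v = c * v"
      by (rule exI[of _ 1]) simp
    with assms show ?thesis
      unfolding proj_rel_def p by blast
  qed
  then have "k = multiplicity (linear_form p) F"
    if "\<forall>q\<in>proj_rel `` {p}. multiplicity (linear_form q) F = k" for k
    using that by (metis (no_types))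
  with mult show ?thesis
    unfolding root_mult_def by (intro the_equality) blast+
qed

end

theory Submission
  imports Defs
begin

(* Fix representatives of the r prescribed roots, with linear forms L_1, ..., L_r. For each
   admissible rearrangement nu, the product of the L_i^(nu_i) is the product of the L_i^(a_i)
   times a form of degree D = |mu| - sum a. Forms of degree D make up a space of dimension D + 1,
   so the at least D + 2 products satisfy a nontrivial linear relation, and the terms with nonzero
   coefficient in this relation are a common radical solution. *)

section \<open>Linear algebra: more unknowns than equations\<close>

text \<open>Gaussian elimination, by induction on the number \<open>n\<close> of equations:
  \<open>g x j\<close> is the coefficient of the unknown \<open>x\<close> in equation
  \<open>j\<close>. The last equation is either trivial or can be solved for one unknown.\<close>

lemma homogeneous_linear_system_nontrivial_solution:
  fixes g :: "'a \<Rightarrow> nat \<Rightarrow> 'b::field"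
  assumes "finite A" "n < card A"
  shows "\<exists>c. (\<exists>x\<in>A. c x \<noteq> 0) \<and> (\<forall>j<n. (\<Sum>x\<in>A. c x * g x j) = 0)"
  using assms
proof (induction n arbitrary: A g)
  case 0
  then have "A \<noteq> {}" by auto
  then show ?case by (intro exI[of _ "\<lambda>_. 1"]) auto
next
  case (Suc n)
  show ?case
  proof (cases "\<forall>x\<in>A. g x n = 0")
    case True
    obtain c where "\<exists>x\<in>A. c x \<noteq> 0" "\<forall>j<n. (\<Sum>x\<in>A. c x * g x j) = 0"
      using Suc.IH[of A g] Suc.prems by auto
    with True show ?thesis
      by (intro exI[of _ c]) (auto simp: less_Suc_eq)
  next
    case False
    then obtain y where y: "y \<in> A" "g y n \<noteq> 0" by blast
    define B where "B = A - {y}"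
    have B: "finite B" "n < card B" "y \<notin> B" "A = insert y B"
      using Suc.prems y by (auto simp: B_def)
    \<comment> \<open>Solving equation \<open>n\<close> for the pivot unknown \<open>y\<close> and
      substituting into equation \<open>j\<close> changes the coefficient of \<open>x\<close> to
      this difference.\<close>
    obtain c where c: "\<exists>x\<in>B. c x \<noteq> 0"
      "\<forall>j<n. (\<Sum>x\<in>B. c x * (g x j - g x n / g y n * g y j)) = 0"
      using Suc.IH[of B "\<lambda>x j. g x j - g x n / g y n * g y j"] B by auto
    \<comment> \<open>The value \<open>- s\<close> at \<open>y\<close> is the one that equation
      \<open>n\<close> forces.\<close>
    define s where "s = (\<Sum>x\<in>B. c x * g x n) / g y n"
    define c' where "c' = c(y := - s)"
    have sum: "(\<Sum>x\<in>A. c' x * g x j) = (\<Sum>x\<in>B. c x * g x j) - s * g y j" for j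
    proof -
      have "(\<Sum>x\<in>B. c' x * g x j) = (\<Sum>x\<in>B. c x * g x j)"
        using B(3) by (intro sum.cong) (auto simp: c'_def)
      then show ?thesis using B by (simp add: c'_def)
    qed
    have "(\<Sum>x\<in>A. c' x * g x j) = 0" if "j < Suc n" for j
    proof (cases "j = n")
      case True
      then show ?thesis using y by (simp add: sum s_def)
    next
      case False
      with that have "0 = (\<Sum>x\<in>B. c x * (g x j - g x n / g y n * g y j))"
        using c(2) by simp
      also have "\<dots> = (\<Sum>x\<in>B. c x * g x j) - s * g y j"
        by (simp add: s_def right_diff_distrib sum_subtractf sum_distrib_right sum_divide_distrib
            mult.assoc)
      finally show ?thesis by (simp add: sum)
    qed
    moreover have "\<exists>x\<in>A. c' x \<noteq> 0"
      using c(1) B by (auto simp: c'_def)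
    ultimately show ?thesis by blast
  qed
qed

section \<open>Homogeneous forms and their linear dependence\<close>

lemma homogeneous_mult:
  assumes "homogeneous d F" "homogeneous e G"
  shows "homogeneous (d + e) (F * G)"
  unfolding homogeneous_def
proof (intro allI impI)
  fix i j
  assume "coeff (coeff (F * G) j) i \<noteq> 0"
  \<comment> \<open>A nonzero coefficient of the product needs a nonzero term in this double
    convolution; both factors of that term then have known degree.\<close>
  then have "(\<Sum>k\<le>j. \<Sum>l\<le>i. coeff (coeff F k) l * coeff (coeff G (j - k)) (i - l)) \<noteq> 0"
    by (simp add: coeff_mult coeff_sum)
  then obtain k where k: "k \<le> j"
    "(\<Sum>l\<le>i. coeff (coeff F k) l * coeff (coeff G (j - k)) (i - l)) \<noteq> 0"
    by (metis (no_types, lifting) atMost_iff sum.neutral)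
  then obtain l where l: "l \<le> i" "coeff (coeff F k) l * coeff (coeff G (j - k)) (i - l) \<noteq> 0"
    by (metis (no_types, lifting) atMost_iff sum.neutral)
  then have "l + k = d" "i - l + (j - k) = e"
    using assms by (auto simp: homogeneous_def)
  with k l show "i + j = d + e" by linarith
qed

lemma homogeneous_1: "homogeneous 0 1"
  by (auto simp: homogeneous_def coeff_1 split: if_splits)

lemma homogeneous_linear_form: "homogeneous 1 (linear_form p)"
  by (auto simp: homogeneous_def linear_form_def coeff_pCons split: prod.splits nat.splits)

lemma homogeneous_smult: "homogeneous d F \<Longrightarrow> homogeneous d (smult [:c:] F)"
  by (auto simp: homogeneous_def)

lemma homogeneous_sum:
  assumes "\<And>x. x \<in> A \<Longrightarrow> homogeneous d (F x)"
  shows "homogeneous d (\<Sum>x\<in>A. F x)"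
  unfolding homogeneous_def
proof (intro allI impI)
  fix i j
  assume "coeff (coeff (\<Sum>x\<in>A. F x) j) i \<noteq> 0"
  then have "(\<Sum>x\<in>A. coeff (coeff (F x) j) i) \<noteq> 0"
    by (simp add: coeff_sum)
  then obtain x where "x \<in> A" "coeff (coeff (F x) j) i \<noteq> 0"
    by (metis (no_types, lifting) sum.neutral)
  with assms show "i + j = d" by (auto simp: homogeneous_def)
qed

lemma homogeneous_prod_linear_form_power:
  "homogeneous (\<Sum>i\<in>I. e i) (\<Prod>i\<in>I. linear_form (p i) ^ e i)"
proof (induction I rule: infinite_finite_induct)
  case (insert x I)
  have "homogeneous k (linear_form (p x) ^ k)" for k
    by (induction k) (use homogeneous_mult[OF homogeneous_linear_form] in \<open>auto simp: homogeneous_1\<close>)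
  with insert show ?case by (simp add: homogeneous_mult)
qed (simp_all add: homogeneous_1)

text \<open>Homogeneity leaves only the \<open>d + 1\<close> coefficients of x^(d-j) y^j that can be
  nonzero.\<close>

lemma homogeneous_eq_0I:
  assumes "homogeneous d F" "\<And>j. j \<le> d \<Longrightarrow> coeff (coeff F j) (d - j) = 0"
  shows "F = 0"
proof -
  have "coeff (coeff F j) i = 0" for i j
    using assms unfolding homogeneous_def by (metis diff_add_inverse2 le_add2)
  then show ?thesis by (auto intro!: poly_eqI)
qed

text \<open>A linear relation amounts to one equation for each of the \<open>d + 1\<close>
  coefficients, fewer than the number of forms.\<close>

lemma forms_linearly_dependent:
  assumes "finite A" "d + 1 < card A" "\<And>x. x \<in> A \<Longrightarrow> homogeneous d (F x)"
  obtains c where "\<exists>x\<in>A. c x \<noteq> 0" "(\<Sum>x\<in>A. smult [:c x:] (F x)) = 0"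
proof -
  obtain c where c: "\<exists>x\<in>A. c x \<noteq> 0"
    "\<forall>j<d + 1. (\<Sum>x\<in>A. c x * coeff (coeff (F x) j) (d - j)) = 0"
    using homogeneous_linear_system_nontrivial_solution
      [OF assms(1,2), of "\<lambda>x j. coeff (coeff (F x) j) (d - j)"] by blast
  have "(\<Sum>x\<in>A. smult [:c x:] (F x)) = 0"
    using c(2) assms(3)
    by (intro homogeneous_eq_0I[of d] homogeneous_sum homogeneous_smult) (auto simp: coeff_sum)
  with c(1) that show ?thesis by blast
qed

section \<open>Zeros and multiplicities of linear forms on the projective line\<close>

lemma eval_form_mult: "eval_form (F * G) q = eval_form F q * eval_form G q"
  by (cases q) (simp add: eval_form_def)

lemma eval_form_prod_power:
  "eval_form (\<Prod>i\<in>I. F i ^ e i) q = (\<Prod>i\<in>I. eval_form (F i) q ^ e i)"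
  by (cases q) (simp add: eval_form_def poly_prod poly_power)

lemma eval_form_smult: "eval_form (smult [:c:] F) q = c * eval_form F q"
  by (cases q) (simp add: eval_form_def)

lemma eval_linear_form_self: "eval_form (linear_form p) p = 0"
  by (cases p) (simp add: eval_form_def linear_form_def)

text \<open>The value at \<open>q\<close> is the determinant of the coordinate vectors, up to sign,
  so it vanishes exactly when they are proportional.\<close>

lemma eval_linear_form_eq_0_iff:
  assumes "p \<noteq> (0, 0)" "q \<noteq> (0, 0)"
  shows "eval_form (linear_form p) q = 0 \<longleftrightarrow> (p, q) \<in> proj_rel"
proof -
  obtain u v u' v' where pq: "p = (u, v)" "q = (u', v')" by fastforce
  have "\<exists>c. c \<noteq> 0 \<and> u' = c * u \<and> v' = c * v" if "v * u' = u * v'"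
  proof (cases "u = 0")
    case True
    with assms that pq show ?thesis
      by (intro exI[of _ "v' / v"]) auto
  next
    case False
    with assms that pq show ?thesis
      by (intro exI[of _ "u' / u"]) (auto simp: field_simps)
  qed
  with assms pq show ?thesis
    by (auto simp: eval_form_def linear_form_def proj_rel_def algebra_simps)
qed

lemma equiv_proj_rel: "equiv (UNIV - {(0, 0)}) proj_rel"
proof (rule equivI)
  show "proj_rel \<subseteq> (UNIV - {(0, 0)}) \<times> (UNIV - {(0, 0)})"
    by (auto simp: proj_rel_def)
  show "refl_on (UNIV - {(0, 0)}) proj_rel"
    by (auto simp: proj_rel_def refl_on_def intro!: exI[of _ 1])
  show "sym proj_rel"
  proof (rule symI)
    fix p q assume "(p, q) \<in> proj_rel"
    then obtain u v c where "p = (u, v)" "q = (c * u, c * v)" "p \<noteq> (0, 0)" "c \<noteq> 0"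
      by (auto simp: proj_rel_def)
    then show "(q, p) \<in> proj_rel"
      by (auto simp: proj_rel_def intro!: exI[of _ "inverse c"])
  qed
  show "trans proj_rel"
  proof (rule transI)
    fix p q s assume "(p, q) \<in> proj_rel" "(q, s) \<in> proj_rel"
    then obtain u v c e where "p = (u, v)" "p \<noteq> (0, 0)" "c \<noteq> 0" "e \<noteq> 0"
      "s = (e * (c * u), e * (c * v))"
      by (auto simp: proj_rel_def)
    then show "(p, s) \<in> proj_rel"
      by (auto simp: proj_rel_def intro!: exI[of _ "e * c"])
  qed
qed

text \<open>Evaluation at \<open>p\<close> is multiplicative and kills \<open>linear_form p\<close>,
  which therefore cannot divide \<open>G\<close>. Cancelling the \<open>k\<close>-th power excludes
  a higher one.\<close>

lemma multiplicity_linear_form: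
  assumes "p \<noteq> (0, 0)" "eval_form G p \<noteq> 0"
  shows "multiplicity (linear_form p) (linear_form p ^ k * G) = k"
proof (rule multiplicity_eqI)
  have "linear_form p \<noteq> 0"
    using assms(1) by (cases p) (auto simp: linear_form_def)
  moreover have "\<not> linear_form p dvd G"
    using assms(2) by (auto simp: eval_form_mult eval_linear_form_self elim!: dvdE)
  ultimately show "\<not> linear_form p ^ Suc k dvd linear_form p ^ k * G"
    by (simp only: power_Suc2 dvd_mult_cancel_left power_not_zero simp_thms)
qed simp

section \<open>Forms with prescribed roots\<close>

locale prescribed_roots =
  fixes p :: "nat \<Rightarrow> complex \<times> complex" and r :: nat
  assumes nonzero: "i < r \<Longrightarrow> p i \<noteq> (0, 0)"
    and distinct_classes: "i < r \<Longrightarrow> j < r \<Longrightarrow> (p i, p j) \<in> proj_rel \<Longrightarrow> i = j"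
begin

definition root :: "nat \<Rightarrow> (complex \<times> complex) set" where
  "root i = proj_rel `` {p i}"

text \<open>The scalar is built in so that a term of a linear relation is again a
  \<open>root_form\<close>; for \<open>c = 0\<close> it is the zero form.\<close>

definition root_form :: "complex \<Rightarrow> nat list \<Rightarrow> bpoly" where
  "root_form c e = smult [:c:] (\<Prod>i<r. linear_form (p i) ^ (e ! i))"

lemma inj_root: "inj_on root {..<r}"
proof (rule inj_onI)
  fix i j assume "i \<in> {..<r}" "j \<in> {..<r}" "root i = root j"
  then show "i = j"
    using distinct_classes nonzero eq_equiv_class_iff[OF equiv_proj_rel, of "p i" "p j"]
    by (auto simp: root_def)
qed

text \<open>A product vanishes exactly where one of its factors does, and positive exponents make
  every prescribed point a zero.\<close>

lemma form_roots_root_form: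
  assumes "c \<noteq> 0" "\<And>i. i < r \<Longrightarrow> 0 < e ! i"
  shows "form_roots (root_form c e) = root ` {..<r}"
proof -
  have zero_iff: "eval_form (root_form c e) q = 0 \<longleftrightarrow> (\<exists>i<r. (p i, q) \<in> proj_rel)"
    if "q \<noteq> (0, 0)" for q
    using that assms nonzero eval_linear_form_eq_0_iff[of "p _" q]
    by (force simp: root_form_def eval_form_smult eval_form_prod_power)
  show ?thesis
  proof (intro subset_antisym subsetI)
    fix P assume P: "P \<in> form_roots (root_form c e)"
    then obtain q where q: "q \<noteq> (0, 0)" "P = proj_rel `` {q}"
      by (auto simp: form_roots_def CP1_def elim!: quotientE)
    then have "q \<in> P"
      using equiv_class_self[OF equiv_proj_rel] by auto
    then have "eval_form (root_form c e) q = 0"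
      using P by (auto simp: form_roots_def)
    then obtain i where "i < r" "(p i, q) \<in> proj_rel"
      using zero_iff q by auto
    then show "P \<in> root ` {..<r}"
      using equiv_class_eq[OF equiv_proj_rel, of "p i" q] q by (auto simp: root_def)
  next
    fix P assume "P \<in> root ` {..<r}"
    then obtain i where i: "i < r" "P = proj_rel `` {p i}"
      by (auto simp: root_def)
    have "eval_form (root_form c e) q = 0" if "q \<in> P" for q
    proof -
      have "(p i, q) \<in> proj_rel" using that i by auto
      moreover from this have "q \<noteq> (0, 0)" by (auto simp: proj_rel_def)
      ultimately show ?thesis using zero_iff i by blast
    qed
    moreover have "P \<in> CP1"
      using i nonzero by (auto simp: CP1_def intro!: quotientI)
    ultimately show "P \<in> form_roots (root_form c e)"
      by (auto simp: form_roots_def)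
  qed
qed

text \<open>The factor of index \<open>k\<close> contributes \<open>e ! k\<close>; the cofactor
  \<open>G\<close> is nonzero at \<open>p k\<close> because the prescribed points are
  distinct.\<close>

lemma root_mult_root_form:
  assumes "c \<noteq> 0" "k < r"
  shows "root_mult (root_form c e) (root k) = e ! k"
proof -
  define G where "G = smult [:c:] (\<Prod>i\<in>{..<r} - {k}. linear_form (p i) ^ (e ! i))"
  have "root_form c e = linear_form (p k) ^ (e ! k) * G"
    using assms by (simp add: root_form_def G_def prod.remove[of "{..<r}" k])
  moreover have "eval_form (linear_form (p i)) (p k) \<noteq> 0" if "i < r" "i \<noteq> k" for i
    using that assms nonzero distinct_classes by (auto simp: eval_linear_form_eq_0_iff)
  then have "eval_form G (p k) \<noteq> 0"
    using assms by (auto simp: G_def eval_form_smult eval_form_prod_power)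
  ultimately show ?thesis
    using assms nonzero by (simp add: root_def root_mult_class multiplicity_linear_form)
qed

lemma root_form_in_S_stratum:
  assumes "c \<noteq> 0" "\<And>i. i < r \<Longrightarrow> 0 < e ! i" "length e = r" "mset e = mset \<mu>"
  shows "root_form c e \<in> S_stratum \<mu>"
proof -
  have "linear_form (p i) \<noteq> 0" if "i < r" for i
    using nonzero[OF that] by (cases "p i") (auto simp: linear_form_def)
  then have "root_form c e \<noteq> 0"
    using assms(1) by (auto simp: root_form_def)
  moreover have "sum_list \<mu> = (\<Sum>i<r. e ! i)"
    using assms(3,4) by (metis atLeast0LessThan sum_list_sum_nth sum_mset_sum_list)
  then have "homogeneous (sum_list \<mu>) (root_form c e)"
    by (simp add: root_form_def homogeneous_smult homogeneous_prod_linear_form_power)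
  moreover have "image_mset (root_mult (root_form c e)) (mset_set (form_roots (root_form c e)))
    = mset \<mu>"
  proof -
    \<comment> \<open>Injectivity of \<open>root\<close> turns the multiset over roots into one over
      indices, where the multiplicities are the entries of \<open>e\<close>.\<close>
    have "image_mset (root_mult (root_form c e)) (mset_set (root ` {..<r}))
      = image_mset (\<lambda>k. root_mult (root_form c e) (root k)) (mset_set {..<r})"
      by (simp add: image_mset_mset_set[OF inj_root, symmetric] multiset.map_comp comp_def)
    also have "\<dots> = image_mset ((!) e) (mset_set {..<r})"
      using assms(1) by (intro image_mset_cong) (simp add: root_mult_root_form)
    also have "\<dots> = mset (map ((!) e) [0..<r])"
      by (simp add: mset_map mset_upt atLeast0LessThan)
    also have "\<dots> = mset \<mu>"
      using assms(3,4) map_nth[of e] by simp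
    finally show ?thesis
      using assms(1,2) by (simp add: form_roots_root_form)
  qed
  ultimately show ?thesis by (simp add: S_stratum_def)
qed

text \<open>Proportional forms have the same root multiplicities, and these recover the exponent
  list.\<close>

lemma not_proportional_root_form:
  assumes "c \<noteq> 0" "c' \<noteq> 0" "length e = r" "length e' = r" "e \<noteq> e'"
  shows "\<not> proportional (root_form c e) (root_form c' e')"
proof
  assume "proportional (root_form c e) (root_form c' e')"
  then obtain b where b: "b \<noteq> 0" "root_form c' e' = root_form (b * c) e"
    by (auto simp: proportional_def root_form_def mult.commute)
  have "e' ! k = e ! k" if "k < r" for k
    using root_mult_root_form[of c' k e'] root_mult_root_form[of "b * c" k e] that assms(1,2) b
    by simp
  with assms show False by (metis nth_equalityI)
qed

text \<open>All the products share the factor with exponents \<open>a ! i\<close>. The cofactors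
  have degree \<open>d\<close>, so they are dependent, and multiplying by the common factor lifts
  the relation.\<close>

lemma root_forms_linearly_dependent:
  assumes "finite N" "\<And>e i. e \<in> N \<Longrightarrow> i < r \<Longrightarrow> a ! i \<le> e ! i"
    and "\<And>e. e \<in> N \<Longrightarrow> (\<Sum>i<r. e ! i) = (\<Sum>i<r. a ! i) + d" "d + 1 < card N"
  obtains c where "\<exists>e\<in>N. c e \<noteq> 0" "(\<Sum>e\<in>N. root_form (c e) e) = 0"
proof -
  define G where "G e = (\<Prod>i<r. linear_form (p i) ^ (e ! i - a ! i))" for e
  have "homogeneous d (G e)" if "e \<in> N" for e
  proof -
    \<comment> \<open>The truncated differences are exact since
      \<open>a ! i \<le> e ! i\<close>.\<close>
    have "(\<Sum>i<r. e ! i - a ! i) = (\<Sum>i<r. e ! i) - (\<Sum>i<r. a ! i)"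
      using assms(2)[OF that] by (intro sum_subtractf_nat) auto
    also have "\<dots> = d"
      using assms(3)[OF that] by simp
    finally have "(\<Sum>i<r. e ! i - a ! i) = d" .
    then show ?thesis
      unfolding G_def by (metis homogeneous_prod_linear_form_power)
  qed
  with assms(1,4) obtain c
    where c: "\<exists>e\<in>N. c e \<noteq> 0" "(\<Sum>e\<in>N. smult [:c e:] (G e)) = 0"
    by (rule forms_linearly_dependent)
  have "root_form (c e) e = (\<Prod>i<r. linear_form (p i) ^ (a ! i)) * smult [:c e:] (G e)"
    if "e \<in> N" for e
  proof -
    have "(\<Prod>i<r. linear_form (p i) ^ (e ! i))
      = (\<Prod>i<r. linear_form (p i) ^ (a ! i) * linear_form (p i) ^ (e ! i - a ! i))"
      using assms(2)[OF that] by (intro prod.cong) (auto simp flip: power_add)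
    then show ?thesis by (simp add: root_form_def G_def prod.distrib)
  qed
  then have "(\<Sum>e\<in>N. root_form (c e) e)
    = (\<Prod>i<r. linear_form (p i) ^ (a ! i)) * (\<Sum>e\<in>N. smult [:c e:] (G e))"
    by (simp add: sum_distrib_left)
  with c that show ?thesis by simp
qed

end

section \<open>Choice of representatives and the resulting solution\<close>

lemma CP1_representatives:
  assumes "R \<subseteq> CP1" "finite R" "card R = r"
  obtains p where "prescribed_roots p r" "(\<lambda>i. proj_rel `` {p i}) ` {..<r} = R"
proof -
  obtain h where h: "bij_betw h {..<r} R"
    using ex_bij_betw_nat_finite[OF assms(2)] assms(3) by (auto simp: atLeast0LessThan)
  have "\<exists>q. q \<noteq> (0, 0) \<and> h i = proj_rel `` {q}" if "i < r" for i
  proof -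
    have "h i \<in> CP1" using h that assms(1) by (auto dest: bij_betwE)
    then show ?thesis by (auto simp: CP1_def elim!: quotientE)
  qed
  then obtain p where p: "\<And>i. i < r \<Longrightarrow> p i \<noteq> (0, 0) \<and> h i = proj_rel `` {p i}"
    by metis
  have "prescribed_roots p r"
  proof
    fix i j assume "i < r" "j < r" "(p i, p j) \<in> proj_rel"
    then have "h i = h j"
      using p equiv_class_eq[OF equiv_proj_rel] by auto
    with h \<open>i < r\<close> \<open>j < r\<close> show "i = j"
      by (auto simp: bij_betw_def dest: inj_onD)
  qed (use p in auto)
  moreover have "(\<lambda>i. proj_rel `` {p i}) ` {..<r} = h ` {..<r}"
    using p by auto
  ultimately show ?thesis
    using that h by (simp add: bij_betw_def)
qed

text \<open>The bound on \<open>sum_list a\<close> excludes degenerate cases: for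
  \<open>\<mu> = [1]\<close> and \<open>a = [3]\<close> the count condition reads 0 \<ge> 0, yet all
  forms with the given root are nonzero multiples of one another, so there is no solution.\<close>

theorem theorem3:
  fixes \<mu> a :: "nat list"
  assumes "is_partition \<mu>"
    and "length a = length \<mu>"
    and "\<forall>i<length \<mu>. 0 < a ! i"
    and "sum_list a \<le> sum_list \<mu>"
    and "int (card {\<nu> \<in> permutations_of_multiset (mset \<mu>). \<forall>i<length \<mu>. \<nu> ! i \<ge> a ! i})
           \<ge> int (sum_list \<mu>) - int (sum_list a) + 2"
  shows "admits_strongly_common_radical_solution \<mu>"
  unfolding admits_strongly_common_radical_solution_def
proof (intro allI impI, elim conjE)
  fix R assume R: "R \<subseteq> CP1" "finite R" "card R = length \<mu>"
  define r where "r = length \<mu>"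
  define N where "N = {\<nu> \<in> permutations_of_multiset (mset \<mu>). \<forall>i<length \<mu>. \<nu> ! i \<ge> a ! i}"
  obtain p where p: "prescribed_roots p r" "(\<lambda>i. proj_rel `` {p i}) ` {..<r} = R"
    using CP1_representatives[OF R] unfolding r_def by blast
  interpret prescribed_roots p r by (fact p(1))
  \<comment> \<open>Positivity of the entries of \<open>a\<close> passes to \<open>e\<close>, so
    every prescribed point is really a root.\<close>
  have N: "mset e = mset \<mu>" "length e = r" "\<And>i. i < r \<Longrightarrow> a ! i \<le> e ! i"
    "\<And>i. i < r \<Longrightarrow> 0 < e ! i" if "e \<in> N" for e
  proof -
    show mset: "mset e = mset \<mu>"
      using that by (simp add: N_def permutations_of_multiset_def)
    show le: "a ! i \<le> e ! i" if "i < r" for i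
      using that \<open>e \<in> N\<close> by (auto simp: N_def r_def permutations_of_multiset_def)
    show "length e = r"
      using mset_eq_length[OF mset] by (simp add: r_def)
    show "0 < e ! i" if "i < r" for i
      using le[OF that] assms(3) that unfolding r_def by (metis less_le_trans)
  qed
  have "finite N" by (simp add: N_def)
  have sum_eq: "(\<Sum>i<r. e ! i) = (\<Sum>i<r. a ! i) + (sum_list \<mu> - sum_list a)" if "e \<in> N" for e
  proof -
    have "sum_list e = sum_list \<mu>"
      using N(1)[OF that] by (metis sum_mset_sum_list)
    then show ?thesis
      using N(2)[OF that] assms(2,4) by (simp add: sum_list_sum_nth atLeast0LessThan r_def)
  qed
  \<comment> \<open>The summand 2 in the count condition gives one form more than the dimension D +
    1; the natural-number difference is the true one because
    \<open>sum_list a \<le> sum_list \<mu>\<close>.\<close>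
  have "sum_list \<mu> - sum_list a + 1 < card N"
    using assms(4,5) unfolding N_def by linarith
  with \<open>finite N\<close> N(3) sum_eq
  obtain c where c: "\<exists>e\<in>N. c e \<noteq> 0" "(\<Sum>e\<in>N. root_form (c e) e) = 0"
    by (rule root_forms_linearly_dependent)
  \<comment> \<open>Terms with coefficient 0 are zero forms, which lie outside
    \<open>S_stratum \<mu>\<close>; discarding them leaves the sum unchanged.\<close>
  define M where "M = {e \<in> N. c e \<noteq> 0}"
  have M: "finite M" "M \<noteq> {}" "(\<Sum>e\<in>M. root_form (c e) e) = 0"
  proof -
    show "finite M" "M \<noteq> {}" using \<open>finite N\<close> c(1) by (auto simp: M_def)
    have "(\<Sum>e\<in>M. root_form (c e) e) = (\<Sum>e\<in>N. root_form (c e) e)"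
      using \<open>finite N\<close> by (intro sum.mono_neutral_left) (auto simp: M_def root_form_def)
    with c(2) show "(\<Sum>e\<in>M. root_form (c e) e) = 0" by simp
  qed
  obtain h where h: "bij_betw h {..<card M} M"
    using ex_bij_betw_nat_finite[OF M(1)] by (auto simp: atLeast0LessThan)
  define f where "f i = root_form (c (h i)) (h i)" for i
  have hM: "h i \<in> N" "c (h i) \<noteq> 0" if "i < card M" for i
    using bij_betwE[OF h] that by (auto simp: M_def)
  have roots: "form_roots (f i) = R" if "i < card M" for i
    using hM[OF that] N(4) p(2) by (simp add: f_def form_roots_root_form root_def)
  have "common_radical_solution \<mu> (card M) f"
    unfolding common_radical_solution_def
  proof (intro conjI allI impI)
    show "0 < card M" using M by (simp add: card_gt_0_iff)
    show "f i \<in> S_stratum \<mu>" if "i < card M" for i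
      using hM[OF that] N by (simp add: f_def root_form_in_S_stratum)
    show "\<not> proportional (f i) (f j)" if "i < card M" "j < card M" "i \<noteq> j" for i j
    proof -
      \<comment> \<open>Different indices give different rearrangements, hence different
        multiplicities at some root.\<close>
      have "h i \<noteq> h j"
        using h that by (auto simp: bij_betw_def dest: inj_onD)
      then show ?thesis
        using hM N(2) that by (simp add: f_def not_proportional_root_form)
    qed
    show "(\<Sum>i<card M. f i) = 0"
      using sum.reindex_bij_betw[OF h, of "\<lambda>e. root_form (c e) e"] M(3) by (simp add: f_def)
    show "form_roots (f i) = form_roots (f j)" if "i < card M" "j < card M" for i j
      using roots that by simp
  qed
  with roots show "\<exists>m f. common_radical_solution \<mu> m f \<and> (\<forall>i<m. form_roots (f i) = R)"
    by blast
qed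

end
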